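(* Let $\lambda,\gamma,\delta\in\mathbb{C}$ with $\lambda-\gamma,\ \lambda-\delta-\gamma\notin\mathbb{Z}_{\ge0}$. Then the inverse of the fusion matrix $J_{q,\delta,\gamma}(\lambda)$ on $M_{q,\delta}\otimes M_{q,\gamma}$ exists, and its matrix elements, defined by $$J_{q,\delta,\gamma}^{-1}(\lambda)(x^\delta_{\delta-2s+2n}\otimes x^\gamma_{\gamma-2n})=\sum_{m=0}^nJ^{\rm inv}_{q,\delta,\gamma,s;m,n}(\lambda)\;x^\delta_{\delta-2s+2m}\otimes x^\gamma_{\gamma-2m}\qquad(m,n,s\in\mathbb{Z},\ 0\le m\le n\le s),$$ have the explicit expression $$J^{\rm inv}_{q,\delta,\gamma,s;m,n}(\lambda)=\frac{[n]_q!}{[m]_q!\,[n-m]_q!}\,q^{-\frac{n-m}2(\lambda+1)}\,q^{\frac{n-m}4(\delta-2s+\gamma)}\,\frac{([\gamma-n+1]_q)_{n-m}}{([\lambda-\gamma+2m+2]_q)_{n-m}}.$$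
   Context: Fix $0<q<1$, $q^z:=\exp(z\ln q)$. Notation: $[a]_q:=\frac{q^{a/2}-q^{-a/2}}{q^{1/2}-q^{-1/2}}$, $[k]_q!:=\prod_{i=1}^k[i]_q$, $([a]_q)_k:=\prod_{i=0}^{k-1}[a+i]_q$. The Verma module $M_{q,\lambda}$ of $\mathcal U_q(sl(2,\mathbb{C}))$ ($\lambda\in\mathbb{C}$) has basis $x^\lambda_{\lambda-2k}$ ($k\in\mathbb{Z}_{\ge0}$), with $hx^\lambda_{\lambda-2k}=(\lambda-2k)x^\lambda_{\lambda-2k}$, $fx^\lambda_{\lambda-2k}=x^\lambda_{\lambda-2k-2}$, $ex^\lambda_{\lambda-2k}=[k]_q[\lambda-k+1]_qx^\lambda_{\lambda-2k+2}$ (zero for $k=0$). A function of $h$ acts on a vector of weight $\nu$ (i.e. $hv=\nu v$, $\mathrm{wt}(v):=\nu$) by substituting $\nu$ for $h$; operators act right to left. The fusion matrix $J_{q,\delta,\gamma}(\lambda)$ is the linear operator on $M_{q,\delta}\otimes M_{q,\gamma}$ given, for weight vectors $w\in M_{q,\delta}$, $v\in M_{q,\gamma}$ with $\lambda-\mathrm{wt}(v),\ \lambda-\mathrm{wt}(v)-\mathrm{wt}(w)\notin\mathbb{Z}_{\ge0}$, by $$J_{q,\delta,\gamma}(\lambda)(w\otimes v)=\sum_{l=0}^\infty\frac{q^{-\frac l2(\lambda+1)}}{[l]_q!}\,f^lq^{lh/4}\cdot w\otimes e^l\frac{q^{lh/4}}{([-\lambda+h]_q)_l}\cdot v .$$ Its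 matrix elements, $J_{q,\delta,\gamma}(\lambda)(x^\delta_{\delta-2s+2n}\otimes x^\gamma_{\gamma-2n})=\sum_{m=0}^nJ_{q,\delta,\gamma,s;m,n}(\lambda)\,x^\delta_{\delta-2s+2m}\otimes x^\gamma_{\gamma-2m}$, are $$J_{q,\delta,\gamma,s;m,n}(\lambda)=\frac{[n]_q!}{[m]_q!\,[n-m]_q!}\,q^{-\frac{n-m}2(\lambda+1)}\,q^{\frac{n-m}4(\delta-2s+\gamma)}\,\frac{([\gamma-n+1]_q)_{n-m}}{([-\lambda+\gamma-2n]_q)_{n-m}}.$$
   Formalization: Added hypothesis: the denominators ([−λ+γ−2n]_q)_l for 0≤l≤n are all nonzero, i.e. the fusion matrix is defined on the whole tensor product; the stated conditions allow λ=γ−2, where the matrix and the claimed formula divide by [0]_q=0. *)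

theory Defs
  imports Complex_Main "HOL-Library.Poly_Mapping"
begin

section \<open>q-numbers\<close>

definition qpow :: "real \<Rightarrow> complex \<Rightarrow> complex" where
  "qpow q z = exp (z * of_real (ln q))"

definition qnum :: "real \<Rightarrow> complex \<Rightarrow> complex" where
  "qnum q a = (qpow q (a / 2) - qpow q (- a / 2)) / (qpow q (1 / 2) - qpow q (- 1 / 2))"

definition qfact :: "real \<Rightarrow> nat \<Rightarrow> complex" where
  "qfact q k = (\<Prod>i = 1..k. qnum q (of_nat i))"

definition qpoch :: "real \<Rightarrow> complex \<Rightarrow> nat \<Rightarrow> complex" where
  "qpoch q a k = (\<Prod>i<k. qnum q (a + of_nat i))"

section \<open>Complex vector spaces with a given basis\<close>

text \<open>The complex vector space with basis indexed by a type is the type of finitely supported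
  functions into the complex numbers. \<open>HOL-Library.Poly_Mapping\<close> only has the additive structure,
  so scalar multiplication is spelled out here.\<close>

definition scl :: "complex \<Rightarrow> ('a \<Rightarrow>\<^sub>0 complex) \<Rightarrow> ('a \<Rightarrow>\<^sub>0 complex)" where
  "scl c v = Poly_Mapping.map ((*) c) v"

definition bvec :: "'a \<Rightarrow> ('a \<Rightarrow>\<^sub>0 complex)" where
  "bvec k = Poly_Mapping.single k 1"

definition lin_ext :: "('a \<Rightarrow> ('b \<Rightarrow>\<^sub>0 complex)) \<Rightarrow> ('a \<Rightarrow>\<^sub>0 complex) \<Rightarrow> ('b \<Rightarrow>\<^sub>0 complex)" where
  "lin_ext \<phi> v = (\<Sum>k\<in>Poly_Mapping.keys v. scl (Poly_Mapping.lookup v k) (\<phi> k))"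

lemma lookup_scl [simp]: "Poly_Mapping.lookup (scl c v) k = c * Poly_Mapping.lookup v k"
  by (simp add: scl_def Poly_Mapping.map.rep_eq when_def)

lemma vector_space_scl: "vector_space (scl :: complex \<Rightarrow> ('a \<Rightarrow>\<^sub>0 complex) \<Rightarrow> _)"
  by standard (auto intro!: poly_mapping_eqI simp: lookup_add algebra_simps)

lemma lin_ext_bvec [simp]: "lin_ext \<phi> (bvec k) = \<phi> k"
  by (auto intro!: poly_mapping_eqI simp: lin_ext_def bvec_def)

lemma lookup_lin_ext:
  "Poly_Mapping.lookup (lin_ext \<phi> v) j =
    (\<Sum>k\<in>Poly_Mapping.keys v. Poly_Mapping.lookup v k * Poly_Mapping.lookup (\<phi> k) j)"
  by (simp add: lin_ext_def lookup_sum)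

lemma linear_lin_ext: "Vector_Spaces.linear scl scl (lin_ext \<phi>)"
proof -
  have sup: "Poly_Mapping.lookup (lin_ext \<phi> v) j =
      (\<Sum>k\<in>A. Poly_Mapping.lookup v k * Poly_Mapping.lookup (\<phi> k) j)"
    if "finite A" "Poly_Mapping.keys v \<subseteq> A" for v A j
    unfolding lookup_lin_ext
    by (rule sum.mono_neutral_left) (use that in \<open>auto simp: in_keys_iff\<close>)
  have add: "lin_ext \<phi> (u + v) = lin_ext \<phi> u + lin_ext \<phi> v" for u v
  proof (rule poly_mapping_eqI)
    fix j
    let ?A = "Poly_Mapping.keys u \<union> Poly_Mapping.keys v"
    show "Poly_Mapping.lookup (lin_ext \<phi> (u + v)) j = Poly_Mapping.lookup (lin_ext \<phi> u + lin_ext \<phi> v) j"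
      using Poly_Mapping.keys_add[of u v]
      by (simp add: lookup_add sup[of ?A] sum.distrib distrib_right)
  qed
  have scale: "lin_ext \<phi> (scl c v) = scl c (lin_ext \<phi> v)" for c v
  proof (rule poly_mapping_eqI)
    fix j
    have "Poly_Mapping.keys (scl c v) \<subseteq> Poly_Mapping.keys v"
      by (auto simp: in_keys_iff)
    then show "Poly_Mapping.lookup (lin_ext \<phi> (scl c v)) j = Poly_Mapping.lookup (scl c (lin_ext \<phi> v)) j"
      by (simp add: sup[of "Poly_Mapping.keys v"] sum_distrib_left mult.assoc)
  qed
  show ?thesis
    by (intro Vector_Spaces.linear.intro module_hom.intro module_hom_axioms.intro
        module.intro vector_space_scl add scale) (auto intro!: poly_mapping_eqI simp: lookup_add algebra_simps)
qed

section \<open>Verma modules\<close>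

text \<open>In the Verma module of highest weight \<open>\<mu>\<close>, \<open>bvec k\<close> is the basis vector of weight \<open>\<mu> - 2 k\<close>.
  The underlying vector space is the same for all \<open>\<mu>\<close>; the operators carry \<open>\<mu>\<close> as a parameter.\<close>

type_synonym verma = "nat \<Rightarrow>\<^sub>0 complex"

type_synonym verma2 = "(nat \<times> nat) \<Rightarrow>\<^sub>0 complex"

definition verma_wt :: "complex \<Rightarrow> nat \<Rightarrow> complex" where
  "verma_wt \<mu> k = \<mu> - 2 * of_nat k"

text \<open>The action of \<open>\<phi>(h)\<close>, for a function \<open>\<phi>\<close>; \<open>h\<close> itself is the case \<open>\<phi> = id\<close>.\<close>

definition verma_h :: "complex \<Rightarrow> (complex \<Rightarrow> complex) \<Rightarrow> verma \<Rightarrow> verma" where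
  "verma_h \<mu> \<phi> = lin_ext (\<lambda>k. scl (\<phi> (verma_wt \<mu> k)) (bvec k))"

definition verma_f :: "verma \<Rightarrow> verma" where
  "verma_f = lin_ext (\<lambda>k. bvec (Suc k))"

definition verma_e :: "real \<Rightarrow> complex \<Rightarrow> verma \<Rightarrow> verma" where
  "verma_e q \<mu> = lin_ext (\<lambda>k. if k = 0 then 0 else
     scl (qnum q (of_nat k) * qnum q (\<mu> - of_nat k + 1)) (bvec (k - 1)))"

text \<open>The tensor product of two Verma modules has the basis \<open>bvec (j, k)\<close>.\<close>

definition tensor :: "verma \<Rightarrow> verma \<Rightarrow> verma2" where
  "tensor w v = lin_ext (\<lambda>j. lin_ext (\<lambda>k. bvec (j, k)) v) w"

section \<open>The fusion matrix\<close>

text \<open>The sum over \<open>l\<close> is \<open>Sum_any\<close>, the sum of a finitely supported family: the term vanishes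
  when \<open>l\<close> exceeds the index of the second basis vector. The operator on the tensor product is
  determined by its values on tensor products of basis vectors, which are weight vectors.\<close>

definition fusion_term ::
  "real \<Rightarrow> complex \<Rightarrow> complex \<Rightarrow> complex \<Rightarrow> nat \<Rightarrow> verma \<Rightarrow> verma \<Rightarrow> verma2" where
  "fusion_term q \<delta> \<gamma> lam l w v =
     scl (qpow q (- (of_nat l / 2) * (lam + 1)) / qfact q l)
       (tensor
         ((verma_f ^^ l) (verma_h \<delta> (\<lambda>h. qpow q (of_nat l * h / 4)) w))
         ((verma_e q \<gamma> ^^ l)
           (verma_h \<gamma> (\<lambda>h. qpow q (of_nat l * h / 4) / qpoch q (- lam + h) l) v)))"

definition fusion :: "real \<Rightarrow> complex \<Rightarrow> complex \<Rightarrow> complex \<Rightarrow> verma2 \<Rightarrow> verma2" where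
  "fusion q \<delta> \<gamma> lam = lin_ext (\<lambda>(j, k). Sum_any (\<lambda>l. fusion_term q \<delta> \<gamma> lam l (bvec j) (bvec k)))"

text \<open>The fusion matrix is defined on the whole tensor product only if none of the denominators
  \<open>([-lam+h]\<^sub>q)\<^sub>l\<close> occurring in it vanishes. On a vector of weight \<open>\<gamma> - 2 n\<close> only the terms with
  \<open>l \<le> n\<close> contribute. Since division by 0 yields 0 in HOL, this has to be required explicitly;
  it does not follow from \<open>lam - \<gamma>\<close> not being a nonnegative integer
  (for \<open>lam = \<gamma> - 2\<close> the denominator with \<open>n = l = 1\<close> vanishes), and \<open>qnum q\<close> vanishes
  at all integer multiples of \<open>2 \<pi> \<i> / ln q\<close>, not only at 0.\<close>

definition fusion_defined :: "real \<Rightarrow> complex \<Rightarrow> complex \<Rightarrow> bool" where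
  "fusion_defined q \<gamma> lam \<longleftrightarrow> (\<forall>n. \<forall>l\<le>n. qpoch q (- lam + verma_wt \<gamma> n) l \<noteq> 0)"

text \<open>For \<open>k \<le> s\<close>, \<open>bvec (s - k, k)\<close> is the tensor product of the basis vectors of weights
  \<open>\<delta> - 2 s + 2 k\<close> and \<open>\<gamma> - 2 k\<close>. The matrix elements of the inverse are its coefficients in this
  basis.\<close>

definition fusion_inv_elem ::
  "real \<Rightarrow> complex \<Rightarrow> complex \<Rightarrow> complex \<Rightarrow> nat \<Rightarrow> nat \<Rightarrow> nat \<Rightarrow> complex" where
  "fusion_inv_elem q \<delta> \<gamma> lam s m n =
     Poly_Mapping.lookup (inv (fusion q \<delta> \<gamma> lam) (tensor (bvec (s - n)) (bvec n))) (s - m, m)"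

end

theory Submission
  imports Defs
begin

text \<open>On each weight space the fusion matrix is unitriangular, so it suffices to check that the
  proposed matrix is a left inverse. After clearing denominators this is the vanishing of the
  alternating \<open>q\<close>-binomial sum of \<open>([c+j]\<^sub>q)\<^sub>N\<close> over \<open>j = 0, \<dots>, N + 1\<close>, whose partial sums
  have a closed product form. Working with the left inverse (rather than the right one) keeps the
  possibly vanishing factor \<open>[lam-\<gamma>+1]\<^sub>q\<close> out of all denominators.\<close>

section \<open>Identities for q-numbers\<close>

lemma qpow_add: "qpow q (a + b) = qpow q a * qpow q b"
  by (simp add: qpow_def exp_add distrib_right)

lemma qpow_nonzero: "qpow q a \<noteq> 0"
  by (simp add: qpow_def)

lemma qpow_minus: "qpow q (- a) = inverse (qpow q a)"
  by (simp add: qpow_def exp_minus)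

lemma qnum_minus: "qnum q (- a) = - qnum q a"
  by (simp add: qnum_def diff_divide_distrib)

text \<open>By additivity of exponents both sides become polynomials in the half-powers at
  \<open>a\<close>, \<open>b\<close>, \<open>x\<close> and at their negatives, times the square of
  the normalisation \<open>d\<close>; these polynomials agree with the six powers taken as
  indeterminates.\<close>

lemma qnum_three_term:
  "qnum q a * qnum q (x + b) + qnum q b * qnum q (x - a) = qnum q (a + b) * qnum q x"
proof -
  define e where "e y = qpow q (y / 2)" for y
  define d where "d = 1 / (qpow q (1 / 2) - qpow q (- 1 / 2))"
  have num: "qnum q y = (e y - e (- y)) * d" for y
    by (simp add: qnum_def e_def d_def)
  have e: "e (u + v) = e u * e v" for u v
    by (simp add: e_def add_divide_distrib qpow_add)
  have num_add: "qnum q (u + v) = (e u * e v - e (- u) * e (- v)) * d" for u v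
    using e[of "- u" "- v"] by (simp add: num e)
  have "qnum q (x - a) = (e x * e (- a) - e (- x) * e a) * d"
    using num_add[of x "- a"] by simp
  then show ?thesis
    unfolding num_add num[of a] num[of b] num[of x] by algebra
qed

lemma qnum_of_nat_nonzero:
  assumes "0 < q" "q < 1" "0 < k"
  shows "qnum q (of_nat k) \<noteq> 0"
proof -
  \<comment> \<open>On real exponents the power is strictly monotone, so it separates
    \<open>x\<close> from \<open>- x\<close>. This is used for the numerator
    (\<open>x = k / 2\<close>) and also for the denominator (\<open>x = 1 / 2\<close>), since a
    quotient by 0 would be 0.\<close>
  have inj: "qpow q (of_real x) \<noteq> qpow q (- of_real x)" if "0 < x" for x
  proof -
    have "exp (x * ln q) \<noteq> exp (- x * ln q)"
      using assms that by simp
    moreover have "qpow q (of_real y) = of_real (exp (y * ln q))" for y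
      by (simp add: qpow_def flip: exp_of_real)
    ultimately show ?thesis
      by (metis of_real_eq_iff of_real_minus)
  qed
  show ?thesis
    using inj[of "real k / 2"] inj[of "1 / 2"] assms by (simp add: qnum_def)
qed

lemma qfact_0 [simp]: "qfact q 0 = 1"
  by (simp add: qfact_def)

lemma qfact_Suc [simp]: "qfact q (Suc k) = qfact q k * qnum q (of_nat (Suc k))"
  by (simp add: qfact_def mult.commute)

lemma qfact_nonzero:
  assumes "0 < q" "q < 1"
  shows "qfact q k \<noteq> 0"
  using qnum_of_nat_nonzero[OF assms] by (induction k) (auto simp del: of_nat_Suc)

lemma qpoch_0 [simp]: "qpoch q a 0 = 1"
  by (simp add: qpoch_def)

lemma qpoch_Suc: "qpoch q a (Suc k) = qpoch q a k * qnum q (a + of_nat k)"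
  by (simp add: qpoch_def)

lemma qpoch_add: "qpoch q a (k + l) = qpoch q a k * qpoch q (a + of_nat k) l"
  by (induction l) (simp_all add: qpoch_Suc add.assoc)

lemma qpoch_Suc_left: "qpoch q a (Suc k) = qnum q a * qpoch q (a + 1) k"
  using qpoch_add[of q a 1 k] by (simp add: qpoch_Suc)

text \<open>Oddness of \<open>qnum\<close> flips the sign of each of the \<open>l\<close> factors;
  reading the product backwards makes it ascending again.\<close>

lemma qpoch_minus: "qpoch q (- x) l = (- 1) ^ l * qpoch q (x - of_nat l + 1) l"
proof (induction l)
  case (Suc l)
  have "qpoch q (x - of_nat (Suc l) + 1) (Suc l) = qnum q (x - of_nat l) * qpoch q (x - of_nat l + 1) l"
    by (simp add: qpoch_Suc_left)
  moreover have "qnum q (- x + of_nat l) = - qnum q (x - of_nat l)"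
    using qnum_minus[of q "x - of_nat l"] by simp
  ultimately show ?case
    by (simp add: qpoch_Suc[of _ "- x"] Suc)
qed simp

section \<open>Alternating q-binomial sums\<close>

definition qbinom :: "real \<Rightarrow> nat \<Rightarrow> nat \<Rightarrow> complex" where
  "qbinom q n k = qfact q n / (qfact q k * qfact q (n - k))"

text \<open>Induction on \<open>p\<close>: the closed form at \<open>p\<close> and the summand at
  \<open>p + 1\<close> differ only in a product of two q-numbers, and \<open>qnum_three_term\<close>
  combines these. The bound on \<open>p\<close> keeps \<open>N - p\<close> a true difference, so the
  summand \<open>N + 1\<close> is treated separately.\<close>

lemma alternating_qbinom_partial_sum:
  assumes "0 < q" "q < 1"
  shows "p \<le> N \<Longrightarrow> (\<Sum>j\<le>p. (- 1) ^ j * qbinom q (Suc N) j * qpoch q (c + of_nat j) N) =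
    (- 1) ^ p * qbinom q N p * qpoch q (c + of_nat p) (N - p) * qpoch q (c + of_nat N + 1) p"
proof (induction p)
  case 0
  then show ?case
    by (simp add: qbinom_def qfact_nonzero[OF assms] del: qfact_Suc)
next
  case (Suc p)
  then obtain r where N: "N = Suc p + r"
    using le_Suc_ex by blast
  \<comment> \<open>\<open>A\<close> runs from \<open>[c+p+1]\<close> to \<open>[c+N-1]\<close> and
    \<open>B\<close> from \<open>[c+N+1]\<close> to \<open>[c+N+p]\<close>; the Pochhammer product
    of the new summand is \<open>A\<close>, then \<open>[c+N]\<close>, then
    \<open>B\<close>.\<close>
  define A where "A = qpoch q (c + of_nat p + 1) r"
  define B where "B = qpoch q (c + of_nat N + 1) p"
  have s1: "qpoch q (c + of_nat (Suc p)) (N - Suc p) = A"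
    by (simp add: A_def N algebra_simps)
  have s2: "qpoch q (c + of_nat p) (N - p) = qnum q (c + of_nat p) * A"
    using qpoch_Suc_left[of q "c + of_nat p" r] by (simp add: N A_def)
  have s3: "qpoch q (c + of_nat N + 1) (Suc p) = B * qnum q (c + of_nat N + 1 + of_nat p)"
    by (simp add: B_def qpoch_Suc)
  have "qpoch q (c + of_nat (Suc p)) (r + Suc p) = A * (qnum q (c + of_nat N) * B)"
    using qpoch_add[of q "c + of_nat (Suc p)" r "Suc p"]
      qpoch_Suc_left[of q "c + of_nat N" p]
    by (simp add: A_def B_def N algebra_simps)
  then have s4: "qpoch q (c + of_nat (Suc p)) N = A * (qnum q (c + of_nat N) * B)"
    by (simp add: N add.commute)
  \<comment> \<open>The three-term identity with \<open>a = r + 1\<close>, \<open>b = p + 1\<close>,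
    \<open>x = c + N\<close>, where \<open>a + b = N + 1\<close> and
    \<open>x - a = c + p\<close>.\<close>
  have key: "qnum q (of_nat (Suc r)) * qnum q (c + of_nat N + 1 + of_nat p) +
      qnum q (of_nat (Suc p)) * qnum q (c + of_nat p) =
      qnum q (of_nat (Suc N)) * qnum q (c + of_nat N)"
    using qnum_three_term[of q "of_nat (Suc r)" "c + of_nat N" "of_nat (Suc p)"]
    by (simp add: N algebra_simps)
  have nz: "qfact q k \<noteq> 0" "qnum q (of_nat (Suc k)) \<noteq> 0" for k
    using qfact_nonzero[OF assms] qnum_of_nat_nonzero[OF assms] by blast+
  \<comment> \<open>The common factor of the three q-binomials involved: each is \<open>F\<close>
    times a single q-number, exactly those occurring in \<open>key\<close>.\<close>
  define F where "F = qfact q N /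
    (qfact q p * qfact q r * qnum q (of_nat (Suc p)) * qnum q (of_nat (Suc r)))"
  have b1: "qbinom q N p = F * qnum q (of_nat (Suc p))"
    using nz[of p] nz[of r] by (simp add: qbinom_def F_def N del: of_nat_Suc)
  have b2: "qbinom q N (Suc p) = F * qnum q (of_nat (Suc r))"
    using nz[of p] nz[of r] by (simp add: qbinom_def F_def N del: of_nat_Suc)
  have b3: "qbinom q (Suc N) (Suc p) = F * qnum q (of_nat (Suc N))"
    using nz[of p] nz[of r] by (simp add: qbinom_def F_def N Suc_diff_le del: of_nat_Suc)
  have IH: "(\<Sum>j\<le>p. (- 1) ^ j * qbinom q (Suc N) j * qpoch q (c + of_nat j) N) =
      (- 1) ^ p * (F * qnum q (of_nat (Suc p))) * (qnum q (c + of_nat p) * A) * B"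
    using Suc unfolding b1[symmetric] s2[symmetric] B_def by simp
  have "(\<Sum>j\<le>Suc p. (- 1) ^ j * qbinom q (Suc N) j * qpoch q (c + of_nat j) N) =
      (- 1) ^ Suc p * F * A * B * (qnum q (of_nat (Suc N)) * qnum q (c + of_nat N)
        - qnum q (of_nat (Suc p)) * qnum q (c + of_nat p))"
    unfolding sum.atMost_Suc IH s4 b3 power_Suc
    by algebra
  also have "\<dots> = (- 1) ^ Suc p * F * A * B *
      (qnum q (of_nat (Suc r)) * qnum q (c + of_nat N + 1 + of_nat p))"
    using key by (simp only: eq_diff_eq[symmetric])
  finally show ?case
    unfolding s1 s3 b2 by (simp only: mult_ac)
qed

text \<open>At \<open>p = N\<close> the closed form and the remaining summand
  \<open>j = N + 1\<close> are the same Pochhammer product with opposite signs, both q-binomials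
  being 1.\<close>

lemma alternating_qbinom_sum:
  assumes "0 < q" "q < 1"
  shows "(\<Sum>j\<le>Suc N. (- 1) ^ j * qbinom q (Suc N) j * qpoch q (c + of_nat j) N) = 0"
proof -
  have "qbinom q k k = 1" for k
    by (simp add: qbinom_def qfact_nonzero[OF assms])
  then show ?thesis
    using alternating_qbinom_partial_sum[OF assms order_refl, of N c]
    by (simp add: algebra_simps)
qed

section \<open>Linear extension\<close>

interpretation scl: vector_space "scl :: complex \<Rightarrow> ('a \<Rightarrow>\<^sub>0 complex) \<Rightarrow> _"
  by (rule vector_space_scl)

interpretation lin_ext: Vector_Spaces.linear
  "scl :: complex \<Rightarrow> ('a \<Rightarrow>\<^sub>0 complex) \<Rightarrow> _" "scl :: complex \<Rightarrow> ('b \<Rightarrow>\<^sub>0 complex) \<Rightarrow> _" "lin_ext \<phi>"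
  for \<phi>
  by (rule linear_lin_ext)

lemma lookup_bvec: "Poly_Mapping.lookup (bvec k) j = (if k = j then 1 else 0)"
  by (simp add: bvec_def lookup_single when_def)

lemma lin_ext_lin_ext: "lin_ext \<psi> (lin_ext \<phi> v) = lin_ext (\<lambda>k. lin_ext \<psi> (\<phi> k)) v"
  unfolding lin_ext_def[of \<phi>] lin_ext_def[of "\<lambda>k. lin_ext \<psi> (\<phi> k)"]
  by (simp add: lin_ext.sum lin_ext.scale)

lemma lin_ext_bvec_id: "lin_ext bvec v = v"
  by (rule poly_mapping_eqI)
    (simp add: lookup_lin_ext lookup_bvec if_distrib[of "(*) _"] in_keys_iff cong: if_cong)

text \<open>A basis vector of maximal rank in the support of a vector keeps its coefficient.\<close>

lemma inj_lin_ext_unitriangular: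
  fixes \<psi> :: "'a \<Rightarrow> ('a \<Rightarrow>\<^sub>0 complex)" and rank :: "'a \<Rightarrow> nat"
  assumes diag: "\<And>a. Poly_Mapping.lookup (\<psi> a) a = 1"
    and upper: "\<And>a b. rank a \<le> rank b \<Longrightarrow> a \<noteq> b \<Longrightarrow> Poly_Mapping.lookup (\<psi> a) b = 0"
  shows "inj (lin_ext \<psi>)"
  unfolding lin_ext.inj_iff_eq_0
proof (intro allI impI, rule ccontr)
  fix v
  assume 0: "lin_ext \<psi> v = 0" and "v \<noteq> 0"
  then have ne: "Poly_Mapping.keys v \<noteq> {}"
    by simp
  have "Max (rank ` Poly_Mapping.keys v) \<in> rank ` Poly_Mapping.keys v"
    using ne by (intro Max_in) auto
  then obtain b where b: "b \<in> Poly_Mapping.keys v" and "rank b = Max (rank ` Poly_Mapping.keys v)"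
    by auto
  then have max: "rank a \<le> rank b" if "a \<in> Poly_Mapping.keys v" for a
    using that by simp
  have "Poly_Mapping.lookup (lin_ext \<psi> v) b =
      (\<Sum>a\<in>Poly_Mapping.keys v. if a = b then Poly_Mapping.lookup v a else 0)"
    unfolding lookup_lin_ext by (rule sum.cong) (auto simp: diag upper max)
  also have "\<dots> = Poly_Mapping.lookup v b"
    using b by simp
  finally show False
    using 0 b by (simp add: in_keys_iff)
qed

section \<open>The fusion matrix and its inverse in the weight basis\<close>

lemma tensor_scl_bvec: "tensor (scl a (bvec j)) (scl b (bvec k)) = scl (a * b) (bvec (j, k))"
  by (simp add: tensor_def lin_ext.scale)

lemma tensor_bvec: "tensor (bvec j) (bvec k) = bvec (j, k)"
  by (simp add: tensor_def)

lemma verma_h_bvec: "verma_h \<mu> \<phi> (bvec k) = scl (\<phi> (verma_wt \<mu> k)) (bvec k)"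
  by (simp add: verma_h_def)

lemma verma_f_pow: "(verma_f ^^ l) (scl c (bvec j)) = scl c (bvec (j + l))"
  by (induction l) (simp_all add: verma_f_def lin_ext.scale)

text \<open>Each application of \<open>e\<close> contributes one q-number descending from
  \<open>[k]\<close> and one ascending from \<open>[\<mu>-k+1]\<close>; the first kind collects into
  a quotient of q-factorials, the second into a Pochhammer product.\<close>

lemma verma_e_pow:
  assumes q: "0 < q" "q < 1" and "l \<le> k"
  shows "(verma_e q \<mu> ^^ l) (scl c (bvec k)) =
    scl (c * (qfact q k / qfact q (k - l) * qpoch q (\<mu> - of_nat k + 1) l)) (bvec (k - l))"
  using assms(3)
proof (induction l)
  case 0
  then show ?case
    by (simp add: qfact_nonzero[OF q])
next
  case (Suc l)
  then obtain r where k: "k = Suc l + r"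
    using le_Suc_ex by blast
  have nz: "qfact q r \<noteq> 0" "qnum q (of_nat (Suc r)) \<noteq> 0"
    using qfact_nonzero[OF q] qnum_of_nat_nonzero[OF q] by blast+
  have d: "k - l = Suc r" "k - Suc l = r"
    by (auto simp: k)
  have w: "\<mu> - of_nat (Suc r) + 1 = \<mu> - of_nat k + 1 + of_nat l"
    by (simp add: k)
  have "(verma_e q \<mu> ^^ Suc l) (scl c (bvec k)) = verma_e q \<mu>
     (scl (c * (qfact q k / qfact q (Suc r) * qpoch q (\<mu> - of_nat k + 1) l)) (bvec (Suc r)))"
    using Suc by (simp add: d del: of_nat_Suc qfact_Suc)
  also have "\<dots> = scl (c * (qfact q k / qfact q (Suc r) * qpoch q (\<mu> - of_nat k + 1) l) *
      (qnum q (of_nat (Suc r)) * qnum q (\<mu> - of_nat k + 1 + of_nat l))) (bvec r)"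
    unfolding verma_e_def lin_ext.scale lin_ext_bvec w[symmetric] by simp
  finally show ?case
    using nz by (simp add: d qpoch_Suc del: of_nat_Suc)
qed

text \<open>After \<open>k\<close> applications the highest weight vector is reached, and
  \<open>e\<close> kills it. This makes the series of the fusion matrix finite.\<close>

lemma verma_e_pow_eq_0:
  assumes q: "0 < q" "q < 1" and "k < l"
  shows "(verma_e q \<mu> ^^ l) (scl c (bvec k)) = 0"
proof -
  have e0: "verma_e q \<mu> (scl a (bvec 0)) = 0" for a
    by (simp add: verma_e_def lin_ext.scale)
  have "(verma_e q \<mu> ^^ i) 0 = 0" for i
    by (induction i) (simp_all add: verma_e_def lin_ext.zero)
  moreover obtain i where "l = i + Suc k"
    using less_imp_Suc_add[OF assms(3)] by (metis add.commute add_Suc_right)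
  moreover have "(verma_e q \<mu> ^^ Suc k) (scl c (bvec k)) = 0"
    by (simp add: verma_e_pow[OF q order_refl] e0)
  ultimately show ?thesis
    by (simp only: funpow_add o_apply)
qed

section \<open>Matrix elements on weight spaces\<close>

definition fusion_elem ::
  "real \<Rightarrow> complex \<Rightarrow> complex \<Rightarrow> complex \<Rightarrow> nat \<Rightarrow> nat \<Rightarrow> nat \<Rightarrow> complex" where
  "fusion_elem q \<delta> \<gamma> lam s m n =
     qfact q n / (qfact q m * qfact q (n - m))
     * qpow q (- (of_nat (n - m) / 2) * (lam + 1))
     * qpow q (of_nat (n - m) / 4 * (\<delta> - 2 * of_nat s + \<gamma>))
     * (qpoch q (\<gamma> - of_nat n + 1) (n - m)
        / qpoch q (- lam + \<gamma> - 2 * of_nat n) (n - m))"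

text \<open>The candidate inverse: its denominator is attached to the row \<open>m\<close>, whereas
  that of \<open>fusion_elem\<close> is attached to the column \<open>n\<close>.\<close>

definition fusion_inv_formula ::
  "real \<Rightarrow> complex \<Rightarrow> complex \<Rightarrow> complex \<Rightarrow> nat \<Rightarrow> nat \<Rightarrow> nat \<Rightarrow> complex" where
  "fusion_inv_formula q \<delta> \<gamma> lam s m n =
     qfact q n / (qfact q m * qfact q (n - m))
     * qpow q (- (of_nat (n - m) / 2) * (lam + 1))
     * qpow q (of_nat (n - m) / 4 * (\<delta> - 2 * of_nat s + \<gamma>))
     * (qpoch q (\<gamma> - of_nat n + 1) (n - m)
        / qpoch q (lam - \<gamma> + 2 * of_nat m + 2) (n - m))"

text \<open>One coefficient function encodes a family of upper triangular matrices, one for each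
  total index \<open>s = j + n\<close>, that is, for each weight space of the tensor product. As
  \<open>m \<le> n\<close>, the subtraction is never truncated.\<close>

definition weight_matrix ::
  "(nat \<Rightarrow> nat \<Rightarrow> nat \<Rightarrow> complex) \<Rightarrow> nat \<times> nat \<Rightarrow> verma2" where
  "weight_matrix a = (\<lambda>(j, n). \<Sum>m\<le>n. scl (a (j + n) m n) (bvec (j + n - m, m)))"

text \<open>The term with \<open>l\<close> lowering steps is the entry in row
  \<open>m = n - l\<close>. The two factors in \<open>h\<close> see the weights of both vectors, and
  these add up to the total weight in the exponent.\<close>

lemma fusion_term_bvec:
  assumes q: "0 < q" "q < 1" and l: "l \<le> n"
  shows "fusion_term q \<delta> \<gamma> lam l (bvec j) (bvec n) =
    scl (fusion_elem q \<delta> \<gamma> lam (j + n) (n - l) n) (bvec (j + l, n - l))"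
proof -
  have "of_nat l * verma_wt \<delta> j / 4 + of_nat l * verma_wt \<gamma> n / 4 =
      of_nat l / 4 * (\<delta> - 2 * of_nat (j + n) + \<gamma>)"
    by (simp add: verma_wt_def field_simps)
  then have wt: "qpow q (of_nat l / 4 * (\<delta> - 2 * of_nat (j + n) + \<gamma>)) =
      qpow q (of_nat l * verma_wt \<delta> j / 4) * qpow q (of_nat l * verma_wt \<gamma> n / 4)"
    by (metis qpow_add)
  have den: "- lam + \<gamma> - 2 * of_nat n = - lam + verma_wt \<gamma> n"
    by (simp add: verma_wt_def)
  have l': "n - (n - l) = l"
    using l by simp
  show ?thesis
    unfolding fusion_term_def verma_h_bvec verma_f_pow verma_e_pow[OF q l] tensor_scl_bvec
      scl.scale_scale fusion_elem_def l' wt den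
    by (simp add: mult_ac)
qed

lemma fusion_term_bvec_eq_0:
  assumes "0 < q" "q < 1" "n < l"
  shows "fusion_term q \<delta> \<gamma> lam l (bvec j) (bvec n) = 0"
  by (simp add: fusion_term_def verma_h_bvec verma_e_pow_eq_0[OF assms] tensor_def lin_ext.zero
      verma_f_pow lin_ext.scale)

lemma fusion_eq_lin_ext:
  assumes q: "0 < q" "q < 1"
  shows "fusion q \<delta> \<gamma> lam = lin_ext (weight_matrix (fusion_elem q \<delta> \<gamma> lam))"
proof -
  have "Sum_any (\<lambda>l. fusion_term q \<delta> \<gamma> lam l (bvec j) (bvec n)) =
      weight_matrix (fusion_elem q \<delta> \<gamma> lam) (j, n)" for j n
  proof -
    have "Sum_any (\<lambda>l. fusion_term q \<delta> \<gamma> lam l (bvec j) (bvec n)) =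
        (\<Sum>l\<le>n. fusion_term q \<delta> \<gamma> lam l (bvec j) (bvec n))"
      by (rule Sum_any.expand_superset) (auto, metis fusion_term_bvec_eq_0[OF q] leI)
    also have "\<dots> = (\<Sum>l\<le>n. scl (fusion_elem q \<delta> \<gamma> lam (j + n) (n - l) n) (bvec (j + l, n - l)))"
      by (rule sum.cong) (auto simp: fusion_term_bvec[OF q])
    also have "\<dots> = (\<Sum>m\<le>n. scl (fusion_elem q \<delta> \<gamma> lam (j + n) m n) (bvec (j + n - m, m)))"
      by (rule sum.reindex_bij_witness[of _ "\<lambda>m. n - m" "\<lambda>l. n - l"]) auto
    finally show ?thesis
      by (simp add: weight_matrix_def)
  qed
  then show ?thesis
    by (simp add: fusion_def split_def)
qed

section \<open>Vanishing of the off-diagonal entries of the product\<close>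

lemma fusion_defined_imp_qnum_nonzero:
  assumes "fusion_defined q \<gamma> lam" "2 \<le> t"
  shows "qnum q (lam - \<gamma> + of_nat t) \<noteq> 0"
proof -
  \<comment> \<open>The factor with index \<open>i\<close> of the denominator at \<open>n\<close> is
    \<open>[-(lam-\<gamma>+2n-i)]\<close>; this choice gives \<open>2n - i = t\<close>, and
    \<open>i < n\<close> puts it inside the product of length \<open>n\<close>.\<close>
  define n where "n = t - 1"
  define i where "i = t - 2"
  have t: "2 * n = t + i" "i < n"
    using assms(2) by (auto simp: n_def i_def)
  have "qpoch q (- lam + verma_wt \<gamma> n) n \<noteq> 0"
    using assms(1) by (auto simp: fusion_defined_def)
  then have "qnum q (- lam + verma_wt \<gamma> n + of_nat i) \<noteq> 0"
    using t(2) by (auto simp: qpoch_def)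
  moreover have "2 * of_nat n = (of_nat t + of_nat i :: complex)"
    using arg_cong[OF t(1), of of_nat] by simp
  then have "- lam + verma_wt \<gamma> n + of_nat i = - (lam - \<gamma> + of_nat t)"
    by (simp add: verma_wt_def)
  ultimately show ?thesis
    by (simp only: qnum_minus) simp
qed

text \<open>With \<open>k = m + j\<close> and \<open>N = n - m - 1\<close>, clearing denominators
  turns the sum into a multiple of the alternating q-binomial sum with
  \<open>c = b + 2\<close>.\<close>

lemma fusion_inv_formula_left_inverse:
  assumes q: "0 < q" "q < 1" and defd: "fusion_defined q \<gamma> lam" and "m < n"
  shows "(\<Sum>k=m..n. fusion_inv_formula q \<delta> \<gamma> lam s m k * fusion_elem q \<delta> \<gamma> lam s k n) = 0"
proof -
  obtain N where n: "n = m + Suc N"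
    using assms(4) less_iff_Suc_add by auto
  define b where "b = lam - \<gamma> + 2 * of_nat m"
  \<comment> \<open>\<open>D\<close> is the product from \<open>[b+2]\<close> to
    \<open>[b+2+2N]\<close>. For every \<open>j\<close> the denominator of the inverse is its
    initial block of length \<open>j\<close>, and that of the fusion matrix is, up to sign, its
    final block of length \<open>N + 1 - j\<close>; a middle block of length \<open>N\<close>
    remains as numerator.\<close>
  define D where "D = qpoch q (b + 2) (Suc (2 * N))"
  have nz: "qfact q k \<noteq> 0" for k
    by (rule qfact_nonzero[OF q])
  have "qnum q (b + 2 + of_nat i) \<noteq> 0" for i
    using fusion_defined_imp_qnum_nonzero[OF defd, of "2 * m + 2 + i"]
    by (simp add: b_def algebra_simps)
  then have D: "D \<noteq> 0"
    by (simp add: D_def qpoch_def del: prod.lessThan_Suc)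
  \<comment> \<open>All that does not depend on \<open>j\<close>. The sign comes from reversing the
    \<open>r = N + 1 - j\<close> factors of the fusion denominator.\<close>
  define C where "C = (- 1) ^ Suc N * qfact q n / (qfact q m * qfact q (Suc N))
    * qpow q (- (of_nat (Suc N) / 2) * (lam + 1))
    * qpow q (of_nat (Suc N) / 4 * (\<delta> - 2 * of_nat s + \<gamma>))
    * qpoch q (\<gamma> - of_nat n + 1) (Suc N) / D"
  have term_eq: "fusion_inv_formula q \<delta> \<gamma> lam s m (m + j) * fusion_elem q \<delta> \<gamma> lam s (m + j) n =
      C * ((- 1) ^ j * qbinom q (Suc N) j * qpoch q (b + 2 + of_nat j) N)"
    if j: "j \<le> Suc N" for j
  proof -
    obtain r where r: "Suc N = j + r"
      using le_Suc_ex[OF j] by blast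
    have d: "n - (m + j) = r" "Suc N - j = r" "m + j - m = j"
      using n r by auto
    have nc: "(of_nat n :: complex) = of_nat m + of_nat j + of_nat r"
      by (simp add: n r del: of_nat_Suc flip: of_nat_add)
    have Nc: "(of_nat N :: complex) = of_nat j + of_nat r - 1"
      using arg_cong[OF r, of "of_nat :: nat \<Rightarrow> complex"] by (simp add: algebra_simps)
    define P\<^sub>1 P\<^sub>2 P\<^sub>3 where P_defs: "P\<^sub>1 = qpoch q (b + 2) j"
      "P\<^sub>2 = qpoch q (b + 2 + of_nat j) N" "P\<^sub>3 = qpoch q (b + 2 + of_nat j + of_nat N) r"
    have "Suc (2 * N) = j + (N + r)"
      using r by simp
    then have D_eq: "D = P\<^sub>1 * (P\<^sub>2 * P\<^sub>3)"
      unfolding D_def P_defs by (simp only: qpoch_add)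
    have P1: "qpoch q (lam - \<gamma> + 2 * of_nat m + 2) j = P\<^sub>1"
      by (simp add: P_defs b_def)
    have "lam - \<gamma> + 2 * of_nat n - of_nat r + 1 = b + 2 + of_nat j + of_nat N"
      by (simp add: b_def nc Nc)
    then have P3: "qpoch q (- lam + \<gamma> - 2 * of_nat n) r = (- 1) ^ r * P\<^sub>3"
      using qpoch_minus[of q "lam - \<gamma> + 2 * of_nat n" r] by (simp add: P_defs algebra_simps)
    have shift: "\<gamma> - of_nat n + 1 + of_nat r = \<gamma> - of_nat (m + j) + 1"
      by (simp add: nc)
    \<comment> \<open>The numerators of the two matrix elements are adjacent blocks, so their
      product is independent of \<open>j\<close>.\<close>
    have R: "qpoch q (\<gamma> - of_nat n + 1) (Suc N) =
        qpoch q (\<gamma> - of_nat n + 1) r * qpoch q (\<gamma> - of_nat (m + j) + 1) j"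
      unfolding r add.commute[of j r] qpoch_add shift ..
    have qpow_split: "qpow q (of_nat (Suc N) * z) = qpow q (of_nat j * z) * qpow q (of_nat r * z)" for z
      unfolding qpow_add[symmetric] r by (simp add: distrib_right)
    have Q: "qpow q (- (of_nat (Suc N) / 2) * (lam + 1)) =
        qpow q (- (of_nat j / 2) * (lam + 1)) * qpow q (- (of_nat r / 2) * (lam + 1))"
      using qpow_split[of "- ((lam + 1) / 2)"] by simp
    have W: "qpow q (of_nat (Suc N) / 4 * w) = qpow q (of_nat j / 4 * w) * qpow q (of_nat r / 4 * w)" for w
      using qpow_split[of "w / 4"] by simp
    have sgn: "(- 1 :: complex) ^ Suc N = (- 1) ^ j * (- 1) ^ r"
      by (simp only: r power_add)
    have sq: "(- 1 :: complex) ^ i * ((- 1) ^ i * z) = z" for i z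
      by (simp flip: power_mult_distrib mult.assoc)
    have inv_sgn: "z / ((- 1) ^ r * P\<^sub>3) = (- 1) ^ r * (z / P\<^sub>3)" for z
      by (simp add: divide_simps sq)
    have "P\<^sub>1 \<noteq> 0" "P\<^sub>2 \<noteq> 0" "P\<^sub>3 \<noteq> 0"
      using D by (auto simp: D_eq)
    then show ?thesis
      using nz[of m] nz[of "m + j"] nz[of "Suc N"]
      unfolding C_def fusion_inv_formula_def fusion_elem_def qbinom_def d P1 P3 R Q W sgn
        inv_sgn D_eq P_defs(2)[symmetric]
      by (simp add: mult_ac sq del: qfact_Suc)
  qed
  have "(\<Sum>k=m..n. fusion_inv_formula q \<delta> \<gamma> lam s m k * fusion_elem q \<delta> \<gamma> lam s k n) =
      (\<Sum>j\<le>Suc N. fusion_inv_formula q \<delta> \<gamma> lam s m (m + j) * fusion_elem q \<delta> \<gamma> lam s (m + j) n)"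
    by (rule sum.reindex_bij_witness[of _ "\<lambda>j. m + j" "\<lambda>k. k - m"]) (auto simp: n)
  also have "\<dots> = C * (\<Sum>j\<le>Suc N. (- 1) ^ j * qbinom q (Suc N) j * qpoch q (b + 2 + of_nat j) N)"
    unfolding sum_distrib_left by (rule sum.cong[OF refl], rule term_eq) simp
  also have "\<dots> = 0"
    by (simp only: alternating_qbinom_sum[OF q] mult_zero_right)
  finally show ?thesis .
qed

section \<open>Composition on weight spaces and inversion\<close>

lemma lookup_weight_matrix:
  "Poly_Mapping.lookup (weight_matrix a (j, n)) (i, m) =
    (if m \<le> n \<and> i + m = j + n then a (j + n) m n else 0)"
proof -
  have "Poly_Mapping.lookup (weight_matrix a (j, n)) (i, m) =
      (\<Sum>k\<le>n. if k = m then (if i + m = j + n then a (j + n) m n else 0) else 0)"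
    unfolding weight_matrix_def prod.case lookup_sum
    by (rule sum.cong) (auto simp: lookup_bvec)
  then show ?thesis
    by auto
qed

text \<open>The total index \<open>j + n\<close> is preserved, so composition is the matrix product
  within one weight space; triangularity restricts the inner index to \<open>m..n\<close>.\<close>

lemma lin_ext_weight_matrix:
  "lin_ext (weight_matrix b) (weight_matrix a (j, n)) =
    (\<Sum>m\<le>n. scl (\<Sum>k=m..n. b (j + n) m k * a (j + n) k n) (bvec (j + n - m, m)))"
proof -
  have "lin_ext (weight_matrix b) (weight_matrix a (j, n)) =
      (\<Sum>k\<le>n. \<Sum>m\<le>k. scl (b (j + n) m k * a (j + n) k n) (bvec (j + n - m, m)))"
    by (auto simp: weight_matrix_def lin_ext.sum lin_ext.scale scl.scale_sum_right mult.commute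
        intro!: sum.cong)
  also have "\<dots> = (\<Sum>m\<le>n. \<Sum>k=m..n. scl (b (j + n) m k * a (j + n) k n) (bvec (j + n - m, m)))"
    by (simp add: sum.Sigma, rule sum.reindex_bij_witness[of _ "\<lambda>(m, k). (k, m)" "\<lambda>(k, m). (m, k)"]) auto
  finally show ?thesis
    by (simp add: scl.scale_sum_left)
qed

theorem mainTheorem3:
  fixes q :: real and lam \<gamma> \<delta> :: complex
  assumes q: "0 < q" "q < 1"
    and lg: "lam - \<gamma> \<notin> \<nat>"
    and ldg: "lam - \<delta> - \<gamma> \<notin> \<nat>"
    and defd: "fusion_defined q \<gamma> lam"
  shows "bij (fusion q \<delta> \<gamma> lam) \<and>
    Vector_Spaces.linear scl scl (inv (fusion q \<delta> \<gamma> lam)) \<and>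
    (\<forall>s n. n \<le> s \<longrightarrow>
      inv (fusion q \<delta> \<gamma> lam) (tensor (bvec (s - n)) (bvec n)) =
        (\<Sum>m = 0..n. scl (fusion_inv_elem q \<delta> \<gamma> lam s m n) (tensor (bvec (s - m)) (bvec m)))) \<and>
    (\<forall>s n m. m \<le> n \<and> n \<le> s \<longrightarrow>
      fusion_inv_elem q \<delta> \<gamma> lam s m n =
        qfact q n / (qfact q m * qfact q (n - m))
        * qpow q (- (of_nat (n - m) / 2) * (lam + 1))
        * qpow q (of_nat (n - m) / 4 * (\<delta> - 2 * of_nat s + \<gamma>))
        * (qpoch q (\<gamma> - of_nat n + 1) (n - m)
           / qpoch q (lam - \<gamma> + 2 * of_nat m + 2) (n - m)))"
proof -
  let ?J = "weight_matrix (fusion_elem q \<delta> \<gamma> lam)"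
  let ?K = "weight_matrix (fusion_inv_formula q \<delta> \<gamma> lam)"
  have elem_diag: "fusion_elem q \<delta> \<gamma> lam s n n = 1"
    and inv_diag: "fusion_inv_formula q \<delta> \<gamma> lam s n n = 1" for s n
    using qfact_nonzero[OF q] by (simp_all add: fusion_elem_def fusion_inv_formula_def qpow_def)
  \<comment> \<open>Off the diagonal the entries of the product vanish, and on it they are
    \<open>1 * 1\<close>.\<close>
  have "lin_ext ?K (?J (j, n)) = bvec (j, n)" for j n
  proof -
    have "lin_ext ?K (?J (j, n)) = (\<Sum>m\<le>n. if m = n then bvec (j, n) else 0)"
      unfolding lin_ext_weight_matrix
      by (rule sum.cong)
        (auto simp: elem_diag inv_diag fusion_inv_formula_left_inverse[OF q defd])
    then show ?thesis
      by simp
  qed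
  then have "(\<lambda>k. lin_ext ?K (?J k)) = bvec"
    by auto
  then have left: "lin_ext ?K (lin_ext ?J v) = v" for v
    by (simp add: lin_ext_lin_ext lin_ext_bvec_id)
  \<comment> \<open>A left inverse alone does not suffice in infinite dimension. The candidate never
    raises the second index and fixes the total index, so it is unitriangular with respect to
    \<open>snd\<close>.\<close>
  have "inj (lin_ext ?K)"
    by (rule inj_lin_ext_unitriangular[where rank = snd])
      (auto simp: lookup_weight_matrix inv_diag split: prod.splits if_splits)
  \<comment> \<open>Applying \<open>?K\<close> to both sides gives
    \<open>?K (?J (?K v)) = ?K v\<close>, which holds by \<open>left\<close>; injectivity cancels
    the outer \<open>?K\<close>.\<close>
  then have right: "lin_ext ?J (lin_ext ?K v) = v" for v
    using left by (meson injD)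
  note J = fusion_eq_lin_ext[OF q, of \<delta> \<gamma> lam]
  have bij: "bij (fusion q \<delta> \<gamma> lam)"
    unfolding J using left right by (intro o_bij[where g = "lin_ext ?K"]) auto
  have K: "inv (fusion q \<delta> \<gamma> lam) = lin_ext ?K"
    unfolding J using left right by (intro inv_equality)
  \<comment> \<open>Here \<open>n \<le> s\<close> ensures that \<open>(s - n) + n\<close> and
    \<open>(s - m) + m\<close> both equal \<open>s\<close>, so the coefficient is read off in the
    right weight space.\<close>
  have elem: "fusion_inv_elem q \<delta> \<gamma> lam s m n = fusion_inv_formula q \<delta> \<gamma> lam s m n"
    if "m \<le> n" "n \<le> s" for s m n
    using that by (simp add: fusion_inv_elem_def K tensor_bvec lookup_weight_matrix)
  have "inv (fusion q \<delta> \<gamma> lam) (tensor (bvec (s - n)) (bvec n)) =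
      (\<Sum>m = 0..n. scl (fusion_inv_elem q \<delta> \<gamma> lam s m n) (tensor (bvec (s - m)) (bvec m)))"
    if "n \<le> s" for s n
    using that by (simp add: K tensor_bvec elem atLeast0AtMost weight_matrix_def)
  moreover have "Vector_Spaces.linear scl scl (inv (fusion q \<delta> \<gamma> lam))"
    unfolding K by (rule linear_lin_ext)
  ultimately show ?thesis
    using bij elem unfolding fusion_inv_formula_def by blast
qed

end
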